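(* Let $n\ge 0$ be an integer and let $q,a,b$ be nonzero complex parameters such that no denominator occurring below vanishes. Then $$ {}_4\phi_3\left[\begin{array}{c} q^{-2n},\, a,\, bq^2,\, q^{1-2n}/ab \\ q^{2-2n}/a,\, q^{2-2n}/b,\, abq^3\end{array};q^2,\,q^4\right] =\frac{(a,-q;q)_n\,(bq^2;q)_{n-1}\,(abq^2;q^2)_{n-1}\,\bigl(abq^{2n}(bq-1)+bq^{n}(1-q)+1-b\bigr)} {(1-abq^{2n+1})\,(abq^2;q)_{n-1}\,(a,b;q^2)_n}. $$
   Context: For an integer $n\ge 0$, $(x;q)_n=\prod_{i=0}^{n-1}(1-xq^i)$ (so $(x;q)_0=1$), and $(x_1,\ldots,x_m;q)_n=\prod_{i=1}^m (x_i;q)_n$; $(x;q^2)_n$ is the same with $q$ replaced by $q^2$. For index $-1$ (occurring only when $n=0$) the usual convention is $(x;q)_{-1}=1/(1-xq^{-1})$ and $(x;q^2)_{-1}=1/(1-xq^{-2})$. The basic hypergeometric series is $${}_4\phi_3\left[\begin{array}{c} a_1,a_2,a_3,a_4\\ b_1,b_2,b_3\end{array};q,z\right]=\sum_{k\ge 0}\frac{(a_1,a_2,a_3,a_4;q)_k\,z^k}{(q,b_1,b_2,b_3;q)_k}.$$ In the claim the base is $q^2$ (replace $q$ by $q^2$ in the definition), the argument is $z=q^4$, and $a_1=q^{-2n}$, so the series terminates: it denotes the finite sum over $0\le k\le n$. Here $q^{c}/ab$ means $q^{c}/(ab)$. The identity is to be understood as an identity of rational functions in $a,b,q$, i.e.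 valid whenever no denominator vanishes. *)

theory Defs
  imports Complex_Main
begin

text \<open>
  The q-shifted factorial, with an integer index. The second branch is the usual extension
  to negative indices; at index \<open>-1\<close> it is \<open>1 / (1 - x / q)\<close>.
\<close>

definition qpoch :: "complex \<Rightarrow> complex \<Rightarrow> int \<Rightarrow> complex" where
  "qpoch x q m =
     (if 0 \<le> m then \<Prod>i<nat m. 1 - x * q ^ i
      else 1 / (\<Prod>i=1..nat (- m). 1 - x / q ^ i))"

definition qpochs :: "complex list \<Rightarrow> complex \<Rightarrow> int \<Rightarrow> complex" where
  "qpochs xs q m = (\<Prod>x\<leftarrow>xs. qpoch x q m)"

definition phi43 ::
  "complex \<Rightarrow> complex \<Rightarrow> complex \<Rightarrow> complex \<Rightarrow> complex \<Rightarrow> complex \<Rightarrow> complex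
    \<Rightarrow> complex \<Rightarrow> complex \<Rightarrow> complex" where
  "phi43 a1 a2 a3 a4 b1 b2 b3 q z =
     (\<Sum>k. qpochs [a1, a2, a3, a4] q (int k) * z ^ k / qpochs [q, b1, b2, b3] q (int k))"

lemma qpoch_minus_one: "qpoch x q (-1) = 1 / (1 - x / q)"
  by (simp add: qpoch_def)

text \<open>
  If an upper parameter is \<open>q\<close> to the power \<open>-n\<close>, all terms with \<open>k > n\<close> have numerator 0
  and hence vanish, even where their denominators do: the series is the finite sum over
  \<open>k \<le> n\<close>.
\<close>

lemma phi43_terminating:
  assumes "q \<noteq> 0"
  shows "phi43 (q powi (- int n)) a2 a3 a4 b1 b2 b3 q z =
    (\<Sum>k\<le>n. qpochs [q powi (- int n), a2, a3, a4] q (int k) * z ^ k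
             / qpochs [q, b1, b2, b3] q (int k))"
  unfolding phi43_def
proof (rule suminf_finite)
  fix k assume "k \<notin> {..n}"
  then have "n < k" by simp
  moreover have "1 - q powi (- int n) * q ^ n = 0"
    using assms by (simp add: power_int_minus)
  ultimately have "qpoch (q powi (- int n)) q (int k) = 0"
    unfolding qpoch_def by (auto intro!: prod_zero bexI[of _ n])
  then show "qpochs [q powi (- int n), a2, a3, a4] q (int k) * z ^ k
             / qpochs [q, b1, b2, b3] q (int k) = 0"
    by (simp add: qpochs_def)
qed simp

end

theory Submission
  imports Defs
begin

text \<open>
  Write \<open>p = q\<^sup>2\<close> and \<open>c = abq\<close>. Reversing the order of the factors in
  \<open>(p\<^bsup>1-n\<^esup>/a; p)\<^sub>k\<close>, \<open>(p\<^bsup>1-n\<^esup>/b; p)\<^sub>k\<close>,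
  \<open>(p\<^bsup>-n\<^esup>; p)\<^sub>k\<close> and
  \<open>(q p\<^bsup>-n\<^esup>/(ab); p)\<^sub>k\<close> turns the series into a convolution:
  up to a factor independent of \<open>k\<close>, the \<open>k\<close>-th term is
  \<open>q\<^sup>k h\<^sub>k g\<^bsub>n-k\<^esub>\<close>, where \<open>h\<close> and \<open>g\<close> are the
  coefficients of the series \<open>\<^sub>2\<phi>\<^sub>1\<close> in base \<open>p\<close> with parameters
  \<open>(a, bp; cp)\<close> and \<open>(a, b; c)\<close>. So the left-hand side is, up to
  normalisation, a coefficient of a product of two
  contiguous \<open>\<^sub>2\<phi>\<^sub>1\<close> series at arguments \<open>qt\<close> and \<open>t\<close>, that is, a contiguous
  variant of the q-analogue of Clausen's formula (\<open>reversed_term\<close>).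

  Clausen's formula itself concerns the case of two equal sequences. The sum of
  \<open>q\<^sup>k h\<^sub>k h\<^bsub>n-k\<^esub>\<close> is a quotient of q-shifted factorials
  (\<open>clausen_sum_closed_form\<close>), because it satisfies a first-order recurrence in \<open>n\<close>: once
  the weight \<open>q\<^sup>k\<close> is symmetrised to
  \<open>q\<^sup>k + q\<^bsup>n-k\<^esup>\<close>, the recurrence holds term by term up to a
  telescoping difference (\<open>clausen_sum_Suc\<close>). A second telescoping identity expresses the mixed
  sum with \<open>g\<close> at \<open>n + 1\<close> through the Clausen sum with two copies of \<open>h\<close> at
  \<open>n\<close> (\<open>lowered_sum\<close>); this is where the quadratic polynomial in
  \<open>q\<^sup>n\<close> of the final formula comes from.

  The detour through the Clausen sum keeps the argument free of genericity assumptions. A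
  recurrence in \<open>n\<close> for the mixed sum itself would carry that quadratic polynomial as a leading
  coefficient, which may vanish, whereas every factor divided by below is nonzero under the hypotheses
  of the theorem.
\<close>

section \<open>The q-shifted factorial\<close>

definition qfac :: "complex \<Rightarrow> complex \<Rightarrow> nat \<Rightarrow> complex" where
  "qfac x q n = (\<Prod>i<n. 1 - x * q ^ i)"

lemma qpoch_of_nat: "qpoch x q (int n) = qfac x q n"
  by (simp add: qpoch_def qfac_def)

lemma qfac_0 [simp]: "qfac x q 0 = 1"
  by (simp add: qfac_def)

lemma qfac_Suc: "qfac x q (Suc n) = qfac x q n * (1 - x * q ^ n)"
  by (simp add: qfac_def)

lemma qfac_Suc_shift: "qfac x q (Suc n) = (1 - x) * qfac (x * q) q n"
  unfolding qfac_def prod.lessThan_Suc_shift by (simp add: mult.assoc)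

lemma qfac_nonzero_mono: "qfac x q n \<noteq> 0 \<Longrightarrow> k \<le> n \<Longrightarrow> qfac x q k \<noteq> 0"
  by (auto simp: qfac_def)

lemma qfac_nonzero_factor: "qfac x q n \<noteq> 0 \<Longrightarrow> k < n \<Longrightarrow> 1 - x * q ^ k \<noteq> 0"
  by (auto simp: qfac_def)

lemma qfac_square: "qfac (q ^ 2) (q ^ 2) n = qfac q q n * qfac (- q) q n"
proof (induction n)
  case (Suc n)
  have "1 - q ^ 2 * (q ^ 2) ^ n = (1 - q * q ^ n) * (1 - (- q) * q ^ n)"
    by (simp add: power2_eq_square power_mult_distrib algebra_simps)
  with Suc show ?case by (simp add: qfac_Suc)
qed simp

section \<open>The coefficient form of the q-Clausen formula\<close>

text \<open>
  The coefficient of \<open>t\<^sup>k\<close> in the \<open>\<^sub>2\<phi>\<^sub>1\<close> series with upper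
  parameters \<open>a, b\<close>, lower parameter \<open>abq\<close> and base \<open>q\<^sup>2\<close>.
\<close>

definition clausen_coeff :: "complex \<Rightarrow> complex \<Rightarrow> complex \<Rightarrow> nat \<Rightarrow> complex" where
  "clausen_coeff a b q k =
     qfac a (q ^ 2) k * qfac b (q ^ 2) k / (qfac (q ^ 2) (q ^ 2) k * qfac (a * b * q) (q ^ 2) k)"

lemma clausen_coeff_0 [simp]: "clausen_coeff a b q 0 = 1"
  by (simp add: clausen_coeff_def)

lemma clausen_coeff_Suc:
  "clausen_coeff a b q (Suc k) = clausen_coeff a b q k *
     ((1 - a * (q ^ k) ^ 2) * (1 - b * (q ^ k) ^ 2) /
      ((1 - q ^ 2 * (q ^ k) ^ 2) * (1 - a * b * q * (q ^ k) ^ 2)))"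
  by (simp add: clausen_coeff_def qfac_Suc power_mult [symmetric] ac_simps)

definition clausen_sum :: "complex \<Rightarrow> complex \<Rightarrow> complex \<Rightarrow> nat \<Rightarrow> complex" where
  "clausen_sum a b q n = (\<Sum>k\<le>n. q ^ k * (clausen_coeff a b q k * clausen_coeff a b q (n - k)))"

text \<open>
  Both weights \<open>q\<^sup>k\<close> and \<open>q\<^bsup>n-k\<^esup>\<close> give the same sum. This freedom
  of redistributing weight between them is what makes the telescoping below possible.
\<close>

lemma clausen_sum_flip:
  "(\<Sum>k\<le>n. q ^ (n - k) * (clausen_coeff a b q k * clausen_coeff a b q (n - k))) = clausen_sum a b q n"
  unfolding clausen_sum_def
  by (rule sum.reindex_bij_witness[of _ "\<lambda>k. n - k" "\<lambda>k. n - k"]) auto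

text \<open>
  The summation scheme common to both identities. The terms \<open>f\<close> come from a sum with one more
  summand than \<open>g\<close>, and the surplus term cancels the upper boundary value of the certificate
  \<open>C\<close>.
\<close>

lemma telescope:
  fixes f g C :: "nat \<Rightarrow> complex"
  assumes "C 0 = 0" and "\<And>k. k \<le> n \<Longrightarrow> f k + g k = C (Suc k) - C k"
    and "f (Suc n) = - C (Suc n)"
  shows "(\<Sum>k\<le>Suc n. f k) = - (\<Sum>k\<le>n. g k)"
proof -
  have "(\<Sum>k\<le>n. f k + g k) = (\<Sum>k\<le>n. C (Suc k) - C k)"
    using assms(2) by (intro sum.cong) auto
  also have "\<dots> = C (Suc n)"
    using assms(1) by (simp add: lessThan_Suc_atMost [symmetric] sum_lessThan_telescope)
  finally show ?thesis
    using assms(3) by (simp add: sum.distrib algebra_simps)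
qed

text \<open>
  The rational-function identity behind the recurrence for the Clausen sum, with
  \<open>z = q\<^sup>k\<close>, \<open>v = q\<^bsup>n-k\<^esup>\<close> and \<open>x = q\<^sup>n\<close>. The
  left-hand side is the recurrence operator applied to the summand with the symmetric weight, the
  right-hand side a difference in \<open>k\<close>, both cleared of denominators. The factor
  \<open>v (1 - e x v\<^sup>2)\<close> is found as the solution of a linear system: if the certificate is a
  Laurent polynomial in \<open>v\<close> times the factors that clear the denominators, cancellation of the
  extreme powers of \<open>v\<close> leaves only \<open>v\<close> and \<open>v\<^sup>3\<close>.
\<close>

lemma clausen_certificate:
  fixes a b q z v :: complex
  defines "x \<equiv> z * v" and "e \<equiv> a * b"
  shows "(1 - q * x) * (1 - e * x) * (1 - e * q * x ^ 2) * (z + q * v) *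
           ((1 - a * v ^ 2) * (1 - b * v ^ 2))
         - (1 - a * x) * (1 - b * x) * (1 - e * x ^ 2) * (z + v) *
           ((1 - q ^ 2 * v ^ 2) * (1 - e * q * v ^ 2))
         = (1 - z ^ 2) * (q - e * z ^ 2) * v * (1 - e * x * (q * v) ^ 2) *
           ((1 - a * v ^ 2) * (1 - b * v ^ 2))
         - (1 - a * z ^ 2) * (1 - b * z ^ 2) * v * (1 - e * x * v ^ 2) *
           ((1 - q ^ 2 * v ^ 2) * (1 - e * q * v ^ 2))"
  unfolding x_def e_def by algebra

text \<open>
  Summation of \<open>clausen_certificate\<close>, whose right-hand side becomes a difference of values of
  the \<open>C\<close> below. The symmetric weight doubles the sum, and the factor 2 cancels.
\<close>

lemma clausen_sum_Suc:
  assumes q: "q \<noteq> 0" and nz1: "qfac (q ^ 2) (q ^ 2) (Suc n) \<noteq> 0"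
    and nz2: "qfac (a * b * q) (q ^ 2) (Suc n) \<noteq> 0"
  shows "(1 - q * q ^ n) * (1 - a * b * q ^ n) * (1 - a * b * q * (q ^ n) ^ 2) *
           clausen_sum a b q (Suc n) =
         (1 - a * q ^ n) * (1 - b * q ^ n) * (1 - a * b * (q ^ n) ^ 2) * clausen_sum a b q n"
proof -
  define h where "h = clausen_coeff a b q"
  define e where "e = a * b"
  define X where "X = q ^ n"
  define P1 where "P1 = (1 - q * X) * (1 - e * X) * (1 - e * q * X ^ 2)"
  define P0 where "P0 = (1 - a * X) * (1 - b * X) * (1 - e * X ^ 2)"
  define N where "N z = (1 - a * z ^ 2) * (1 - b * z ^ 2)" for z
  define D where "D z = (1 - q ^ 2 * z ^ 2) * (1 - e * q * z ^ 2)" for z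
  define C where "C k = - (h k * h (Suc n - k) * ((1 - (q ^ k) ^ 2) * (q - e * (q ^ k) ^ 2) / q)
      * (q ^ (Suc n - k) * (1 - e * X * (q ^ (Suc n - k)) ^ 2)))" for k
  define f where "f k = P1 * ((q ^ k + q ^ (Suc n - k)) * (h k * h (Suc n - k)))" for k
  define g where "g k = - (P0 * ((q ^ k + q ^ (n - k)) * (h k * h (n - k))))" for k
  have D_nz: "D (q ^ k) \<noteq> 0" if "k \<le> n" for k
    using qfac_nonzero_factor[OF nz1, of k] qfac_nonzero_factor[OF nz2, of k] that
    by (simp add: D_def e_def power_mult [symmetric] ac_simps)
  have h_Suc: "h (Suc k) = h k * (N (q ^ k) / D (q ^ k))" for k
    unfolding h_def N_def D_def e_def by (rule clausen_coeff_Suc)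
  have "(\<Sum>k\<le>Suc n. f k) = - (\<Sum>k\<le>n. g k)"
  proof (rule telescope)
    show "C 0 = 0" by (simp add: C_def)
  next
    fix k assume k: "k \<le> n"
    define z v where "z = q ^ k" and "v = q ^ (n - k)"
    have X: "X = z * v"
      using k by (simp add: X_def z_def v_def power_add [symmetric])
    have Dz: "D z \<noteq> 0" and Dv: "D v \<noteq> 0"
      using D_nz k by (simp_all add: z_def v_def)
    have n_k: "Suc n - k = Suc (n - k)" using k by simp
    define H K where "H = h k" and "K = h (n - k)"
    have cert: "P1 * (z + q * v) * N v - P0 * (z + v) * D v =
        (1 - z ^ 2) * (q - e * z ^ 2) * v * (1 - e * X * (q * v) ^ 2) * N v
        - N z * v * (1 - e * X * v ^ 2) * D v"
      using clausen_certificate[of q z v a b] unfolding P1_def P0_def N_def D_def e_def X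
      by (simp add: mult.assoc)
    have "f k + g k = H * K * ((P1 * (z + q * v) * N v - P0 * (z + v) * D v) / D v)"
      using Dv by (simp add: f_def g_def n_k h_Suc z_def [symmetric] v_def [symmetric]
          H_def [symmetric] K_def [symmetric] field_simps)
    also have "\<dots> = C (Suc k) - C k"
    proof -
      have Ck: "C k = - (H * (K * (N v / D v)) * ((1 - z ^ 2) * (q - e * z ^ 2) / q)
          * (q * v * (1 - e * X * (q * v) ^ 2)))"
        by (simp add: C_def n_k h_Suc z_def v_def H_def K_def)
      have "C (Suc k) = - (H * (N z / D z) * K * ((1 - (q * z) ^ 2) * (q - e * (q * z) ^ 2) / q)
          * (v * (1 - e * X * v ^ 2)))"
        by (simp add: C_def h_Suc z_def v_def H_def K_def)
      also have "(1 - (q * z) ^ 2) * (q - e * (q * z) ^ 2) / q = D z"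
        using q by (simp add: D_def field_simps power2_eq_square)
      finally have CSk: "C (Suc k) = - (H * K * N z * (v * (1 - e * X * v ^ 2)))"
        using Dz by simp
      show ?thesis
        unfolding cert Ck CSk using Dv q by (simp add: field_simps)
    qed
    finally show "f k + g k = C (Suc k) - C k" .
  next
    show "f (Suc n) = - C (Suc n)"
      using q by (simp add: f_def C_def P1_def h_def X_def field_simps power2_eq_square)
  qed
  moreover have "(\<Sum>k\<le>Suc n. f k) = P1 * (2 * clausen_sum a b q (Suc n))"
    unfolding f_def sum_distrib_left [symmetric] distrib_right sum.distrib h_def clausen_sum_flip
    by (simp only: clausen_sum_def [symmetric] mult_2)
  moreover have "(\<Sum>k\<le>n. g k) = - (P0 * (2 * clausen_sum a b q n))"
    unfolding g_def sum_negf sum_distrib_left [symmetric] distrib_right sum.distrib h_def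
      clausen_sum_flip
    by (simp only: clausen_sum_def [symmetric] mult_2)
  ultimately have "P1 * clausen_sum a b q (Suc n) = P0 * clausen_sum a b q n"
    by (simp del: sum.atMost_Suc)
  then show ?thesis
    unfolding P1_def P0_def X_def e_def .
qed

lemma clausen_sum_closed_form:
  assumes "q \<noteq> 0" and "qfac (q ^ 2) (q ^ 2) n \<noteq> 0" and "qfac (a * b) q n \<noteq> 0"
    and "qfac (a * b * q) (q ^ 2) n \<noteq> 0"
  shows "clausen_sum a b q n = qfac a q n * qfac b q n * qfac (a * b) (q ^ 2) n /
           (qfac q q n * qfac (a * b) q n * qfac (a * b * q) (q ^ 2) n)"
  using assms
proof (induction n)
  case 0
  show ?case by (simp add: clausen_sum_def)
next
  case (Suc n)
  have nz: "1 - q * q ^ n \<noteq> 0" "1 - a * b * q ^ n \<noteq> 0" "1 - a * b * q * (q ^ n) ^ 2 \<noteq> 0"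
    using qfac_nonzero_factor[of q q "Suc n" n] qfac_nonzero_factor[OF Suc.prems(3), of n]
      qfac_nonzero_factor[OF Suc.prems(4), of n] Suc.prems(2)
    by (simp_all add: qfac_square power_mult [symmetric] mult.commute)
  have IH: "clausen_sum a b q n = qfac a q n * qfac b q n * qfac (a * b) (q ^ 2) n /
           (qfac q q n * qfac (a * b) q n * qfac (a * b * q) (q ^ 2) n)"
    using Suc by (simp add: qfac_Suc)
  have sq: "(q ^ 2) ^ n = (q ^ n) ^ 2"
    by (simp add: power_mult [symmetric] mult.commute)
  have "clausen_sum a b q (Suc n) =
      (1 - a * q ^ n) * (1 - b * q ^ n) * (1 - a * b * (q ^ n) ^ 2) * clausen_sum a b q n /
      ((1 - q * q ^ n) * (1 - a * b * q ^ n) * (1 - a * b * q * (q ^ n) ^ 2))"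
    using clausen_sum_Suc[OF Suc.prems(1,2,4)] nz
    by (simp only: nonzero_eq_divide_eq mult_eq_0_iff mult.commute[of "clausen_sum a b q (Suc n)"]
        simp_thms not_False_eq_True)
  then show ?case
    unfolding IH qfac_Suc sq by (simp add: ac_simps)
qed

section \<open>The contiguous convolution\<close>

text \<open>
  This is \<open>1 - abq\<close> times \<open>clausen_coeff a b q k\<close>, written so that it also makes sense
  for \<open>abq = 1\<close>, where the latter has a pole but the theorem still applies.
\<close>

definition lowered_coeff :: "complex \<Rightarrow> complex \<Rightarrow> complex \<Rightarrow> nat \<Rightarrow> complex" where
  "lowered_coeff a b q k =
     qfac a (q ^ 2) k * qfac b (q ^ 2) k * (1 - a * b * q * (q ^ k) ^ 2) /
     (qfac (q ^ 2) (q ^ 2) k * qfac (a * b * q ^ 3) (q ^ 2) k)"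

text \<open>
  Since \<open>(b; p)\<^bsub>k+1\<^esub> = (1 - b) (bp; p)\<^sub>k\<close>, raising the index by one moves from the
  parameter \<open>b\<close> to \<open>bp\<close>. This makes the two kinds of coefficients comparable without dividing
  by a factor \<open>1 - bp\<^sup>k\<close>.
\<close>

lemma lowered_coeff_Suc:
  assumes "qfac (a * b * q ^ 3) (q ^ 2) (Suc k) \<noteq> 0"
  shows "lowered_coeff a b q (Suc k) = clausen_coeff a (b * q ^ 2) q k *
           ((1 - a * (q ^ k) ^ 2) * (1 - b) / (1 - q ^ 2 * (q ^ k) ^ 2))"
proof -
  have sq: "(q ^ 2) ^ k = (q ^ k) ^ 2"
    by (simp add: power_mult [symmetric] mult.commute)
  have c: "a * (b * q ^ 2) * q = a * b * q ^ 3"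
    by (simp add: power2_eq_square power3_eq_cube)
  have shift: "a * b * q * (q ^ Suc k) ^ 2 = a * b * q ^ 3 * (q ^ k) ^ 2"
    by (simp add: power2_eq_square power3_eq_cube)
  show ?thesis
    using assms unfolding lowered_coeff_def clausen_coeff_def qfac_Suc_shift[of b] c shift
    by (simp add: qfac_Suc sq ac_simps)
qed

text \<open>
  The factor \<open>1 - abq\<^bsup>2k+1\<^esup>\<close> stays on the left: at \<open>k = 0\<close> it may be zero.
\<close>

lemma lowered_coeff_step:
  assumes "1 - a * b * q ^ 3 * (q ^ k) ^ 2 \<noteq> 0" and "1 - q ^ 2 * (q ^ k) ^ 2 \<noteq> 0"
  shows "lowered_coeff a b q (Suc k) * ((1 - q ^ 2 * (q ^ k) ^ 2) * (1 - a * b * q * (q ^ k) ^ 2)) =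
         lowered_coeff a b q k * ((1 - a * (q ^ k) ^ 2) * (1 - b * (q ^ k) ^ 2))"
proof -
  have sq: "(q ^ 2) ^ k = (q ^ k) ^ 2"
    by (simp add: power_mult [symmetric] mult.commute)
  have shift: "a * b * q * (q ^ Suc k) ^ 2 = a * b * q ^ 3 * (q ^ k) ^ 2"
    by (simp add: power2_eq_square power3_eq_cube)
  show ?thesis
    using assms unfolding lowered_coeff_def shift by (simp add: qfac_Suc sq)
qed

text \<open>
  The rational-function identity relating the mixed convolution to the Clausen sum; \<open>z\<close>,
  \<open>v\<close> and \<open>x\<close> are as before. The Clausen summand is weighted with
  \<open>(l + y) z - y v\<close>: only the total weight \<open>l\<close> survives the summation, and \<open>y\<close> is
  the redistribution between \<open>z = q\<^sup>k\<close> and \<open>v = q\<^bsup>n-k\<^esup>\<close> for which the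
  difference telescopes. Its value is forced by comparing the coefficients of
  \<open>v\<^sup>3\<close> after eliminating \<open>z = x / v\<close>.
\<close>

lemma lowered_certificate:
  fixes a b q z v y :: complex
  defines "x \<equiv> z * v" and "c \<equiv> a * b * q"
  defines "y \<equiv> x * (a + b * q ^ 2 - q - a * b
                      + a * b * q ^ 2 * x ^ 2 * (1 + c - a - b * q ^ 2))"
  defines "l \<equiv> (1 + q * x) * (1 - a * x) *
                 (a * b * (q * x) ^ 2 * (b * q - 1) + b * (q * x) * (1 - q) + 1 - b)"
  shows "(1 - q ^ 2 * x ^ 2) * (1 - c * q ^ 2 * x ^ 2) * z * ((1 - a * v ^ 2) * (1 - b))
         - ((l + y) * z - y * v) * (1 - q ^ 2 * v ^ 2)
         = - x * (q * (1 - a * z ^ 2) * (1 - b * q ^ 2 * z ^ 2) * (1 - c * v ^ 2) * v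
                    * (1 - q ^ 2 * v ^ 2)
                  - q ^ 2 * (1 - z ^ 2) * (1 - c * z ^ 2) * v * (1 - a * v ^ 2)
                    * (1 - b * q ^ 2 * v ^ 2))"
  unfolding l_def y_def c_def x_def by algebra

text \<open>
  The certificate gives the relation multiplied by \<open>1 + q\<^bsup>n+1\<^esup>\<close>, which is
  nonzero because it divides \<open>1 - q\<^bsup>2n+2\<^esup>\<close>.
\<close>

lemma lowered_sum:
  assumes q: "q \<noteq> 0" and nz1: "qfac (q ^ 2) (q ^ 2) (Suc n) \<noteq> 0"
    and nz2: "qfac (a * b * q ^ 3) (q ^ 2) (Suc n) \<noteq> 0"
  shows "(1 - q ^ Suc n) * (1 - a * b * q * (q ^ Suc n) ^ 2) *
           (\<Sum>k\<le>Suc n. q ^ k * (clausen_coeff a (b * q ^ 2) q k * lowered_coeff a b q (Suc n - k))) =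
         (1 - a * q ^ n) *
           (a * b * (q ^ Suc n) ^ 2 * (b * q - 1) + b * q ^ Suc n * (1 - q) + 1 - b) *
           clausen_sum a (b * q ^ 2) q n"
proof -
  define h where "h = clausen_coeff a (b * q ^ 2) q"
  define u where "u = lowered_coeff a b q"
  define c where "c = a * b * q"
  define X where "X = q ^ n"
  define P1 where "P1 = (1 - q ^ 2 * X ^ 2) * (1 - c * q ^ 2 * X ^ 2)"
  define y where "y = X * (a + b * q ^ 2 - q - a * b
                      + a * b * q ^ 2 * X ^ 2 * (1 + c - a - b * q ^ 2))"
  define l where "l = (1 + q * X) * (1 - a * X) *
                 (a * b * (q * X) ^ 2 * (b * q - 1) + b * (q * X) * (1 - q) + 1 - b)"
  define C where "C k = - (h k * h (Suc n - k) * ((1 - (q ^ k) ^ 2) * (1 - c * (q ^ k) ^ 2))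
      * (q * X * (q ^ (Suc n - k) * (1 - c * (q ^ (Suc n - k)) ^ 2))))" for k
  define f where "f k = P1 * (q ^ k * (h k * u (Suc n - k)))" for k
  define g where "g k = - (((l + y) * q ^ k - y * q ^ (n - k)) * (h k * h (n - k)))" for k
  have c': "a * (b * q ^ 2) * q = c * q ^ 2" and c3: "a * b * q ^ 3 = c * q ^ 2"
    by (simp_all add: c_def power2_eq_square power3_eq_cube)
  have nz: "1 - q ^ 2 * (q ^ k) ^ 2 \<noteq> 0" "1 - c * q ^ 2 * (q ^ k) ^ 2 \<noteq> 0" if "k \<le> n" for k
    using qfac_nonzero_factor[OF nz1, of k] qfac_nonzero_factor[OF nz2[unfolded c3], of k] that
    by (simp_all add: power_mult [symmetric] ac_simps)
  have h_Suc: "h (Suc k) = h k * ((1 - a * (q ^ k) ^ 2) * (1 - b * q ^ 2 * (q ^ k) ^ 2) /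
      ((1 - q ^ 2 * (q ^ k) ^ 2) * (1 - c * q ^ 2 * (q ^ k) ^ 2)))" for k
    unfolding h_def c' [symmetric] by (rule clausen_coeff_Suc)
  have u_Suc: "u (Suc k) = h k * ((1 - a * (q ^ k) ^ 2) * (1 - b) / (1 - q ^ 2 * (q ^ k) ^ 2))"
    if "k \<le> n" for k
    unfolding u_def h_def
    by (rule lowered_coeff_Suc, rule qfac_nonzero_mono[OF nz2]) (use that in simp)
  have "(\<Sum>k\<le>Suc n. f k) = - (\<Sum>k\<le>n. g k)"
  proof (rule telescope)
    show "C 0 = 0" by (simp add: C_def)
  next
    fix k assume k: "k \<le> n"
    define z v where "z = q ^ k" and "v = q ^ (n - k)"
    have X: "X = z * v"
      using k by (simp add: X_def z_def v_def power_add [symmetric])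
    define H K where "H = h k" and "K = h (n - k)"
    define A where "A = 1 - q ^ 2 * v ^ 2"
    define B where "B = 1 - c * q ^ 2 * v ^ 2"
    define A' where "A' = 1 - q ^ 2 * z ^ 2"
    define B' where "B' = 1 - c * q ^ 2 * z ^ 2"
    define M where "M z = (1 - a * z ^ 2) * (1 - b * q ^ 2 * z ^ 2)" for z
    have A: "A \<noteq> 0" "B \<noteq> 0" "A' \<noteq> 0" "B' \<noteq> 0"
      using nz k by (simp_all add: A_def B_def A'_def B'_def z_def v_def)
    have n_k: "Suc n - k = Suc (n - k)" using k by simp
    have cert: "P1 * z * ((1 - a * v ^ 2) * (1 - b)) - ((l + y) * z - y * v) * A
         = - X * (q * M z * (1 - c * v ^ 2) * v * A
                  - q ^ 2 * (1 - z ^ 2) * (1 - c * z ^ 2) * v * M v)"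
      using lowered_certificate[of q z v a b]
      unfolding P1_def l_def y_def c_def A_def M_def X by (simp add: mult.assoc)
    have uk: "u (Suc n - k) = K * ((1 - a * v ^ 2) * (1 - b) / A)"
      using u_Suc[of "n - k"] by (simp add: n_k K_def v_def A_def)
    have hk: "h (Suc n - k) = K * (M v / (A * B))"
      by (simp add: n_k h_Suc K_def v_def A_def B_def M_def)
    have hSk: "h (Suc k) = H * (M z / (A' * B'))"
      by (simp add: h_Suc H_def z_def A'_def B'_def M_def)
    have "f k + g k = H * K * ((P1 * z * ((1 - a * v ^ 2) * (1 - b)) - ((l + y) * z - y * v) * A) / A)"
      unfolding f_def g_def uk H_def [symmetric] K_def [symmetric] z_def [symmetric]
        v_def [symmetric]
      using A(1) by (simp add: field_simps)
    also have "\<dots> = C (Suc k) - C k"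
    proof -
      have pw: "q ^ (Suc n - k) = q * v" by (simp add: n_k v_def)
      have "1 - c * (q * v) ^ 2 = B"
        by (simp add: B_def power_mult_distrib)
      then have "C k = - (H * (K * (M v / (A * B))) * ((1 - z ^ 2) * (1 - c * z ^ 2))
          * (q * X * (q * v * B)))"
        unfolding C_def hk pw H_def [symmetric] z_def [symmetric] by simp
      then have Ck: "C k = - (H * K * (M v / A) * ((1 - z ^ 2) * (1 - c * z ^ 2)) * (q ^ 2 * X * v))"
        using A by (simp add: power2_eq_square)
      have "(1 - (q ^ Suc k) ^ 2) * (1 - c * (q ^ Suc k) ^ 2) = A' * B'"
        by (simp add: A'_def B'_def z_def power_mult_distrib)
      then have "C (Suc k) = - (H * (M z / (A' * B')) * K * (A' * B')
          * (q * X * (v * (1 - c * v ^ 2))))"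
        unfolding C_def hSk by (simp add: v_def K_def)
      then have CSk: "C (Suc k) = - (H * K * M z * (q * X * (v * (1 - c * v ^ 2))))"
        using A by simp
      show ?thesis
        unfolding cert Ck CSk using A by (simp add: field_simps)
    qed
    finally show "f k + g k = C (Suc k) - C k" .
  next
    have "(q ^ Suc n) ^ 2 = q ^ 2 * X ^ 2"
      by (simp add: X_def power_mult_distrib)
    moreover have "u 0 = 1 - c"
      by (simp add: u_def lowered_coeff_def c_def)
    ultimately show "f (Suc n) = - C (Suc n)"
      by (simp add: f_def C_def P1_def h_def X_def mult.assoc)
  qed
  moreover have "(\<Sum>k\<le>Suc n. f k) = P1 * (\<Sum>k\<le>Suc n. q ^ k * (h k * u (Suc n - k)))"
    unfolding f_def by (rule sum_distrib_left [symmetric])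
  moreover have "(\<Sum>k\<le>n. g k) = - (l * clausen_sum a (b * q ^ 2) q n)"
  proof -
    have "(\<Sum>k\<le>n. g k) =
        - ((l + y) * (\<Sum>k\<le>n. q ^ k * (h k * h (n - k)))
           - y * (\<Sum>k\<le>n. q ^ (n - k) * (h k * h (n - k))))"
      unfolding g_def sum_distrib_left sum_subtractf [symmetric] sum_negf [symmetric]
      by (simp add: algebra_simps)
    then show ?thesis
      unfolding h_def clausen_sum_flip clausen_sum_def [symmetric] by (simp add: algebra_simps)
  qed
  ultimately have "(1 + q * X) * ((1 - q * X) * (1 - c * (q * X) ^ 2) *
        (\<Sum>k\<le>Suc n. q ^ k * (h k * u (Suc n - k)))) =
      (1 + q * X) * ((1 - a * X) *
        (a * b * (q * X) ^ 2 * (b * q - 1) + b * (q * X) * (1 - q) + 1 - b) *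
        clausen_sum a (b * q ^ 2) q n)"
    unfolding P1_def l_def by (simp add: algebra_simps power2_eq_square del: sum.atMost_Suc)
  moreover have "1 + q * X \<noteq> 0"
  proof
    assume "1 + q * X = 0"
    then have "(1 + q * X) * (1 - q * X) = 0" by simp
    with nz(1)[of n] show False
      by (simp add: X_def algebra_simps power2_eq_square)
  qed
  ultimately show ?thesis
    unfolding mult_cancel_left by (simp add: h_def u_def c_def X_def del: sum.atMost_Suc)
qed

section \<open>The series as a convolution\<close>

text \<open>
  Both sides have the same ratio of consecutive terms. With \<open>j = n - k - 1\<close>, the factors of
  index \<open>k\<close> such as \<open>1 - p\<^bsup>1-n+k\<^esup>/a = -(1 - a p\<^sup>j)/(a p\<^sup>j)\<close> supply
  exactly the ratio of the coefficients with index \<open>n - k\<close> and \<open>n - k - 1\<close>; the monomials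
  left over turn \<open>q\<^sup>4\<close> into \<open>q\<close>.
\<close>

lemma reversed_term:
  fixes a b q :: complex
  defines "p \<equiv> q ^ 2"
  assumes q: "q \<noteq> 0" and a: "a \<noteq> 0" and b: "b \<noteq> 0"
    and nz1: "qfac p p n \<noteq> 0" and nz2: "qfac (a * b * q ^ 3) p n \<noteq> 0"
    and nz3: "qfac a p n \<noteq> 0" and nz4: "qfac b p n \<noteq> 0"
    and "k \<le> n"
  shows "qfac (1 / p ^ n) p k * qfac a p k * qfac (b * p) p k * qfac (q / p ^ n / (a * b)) p k *
           (q ^ 4) ^ k /
         (qfac p p k * qfac (p / p ^ n / a) p k * qfac (p / p ^ n / b) p k *
           qfac (a * b * q ^ 3) p k) * lowered_coeff a b q n =
         q ^ k * (clausen_coeff a (b * p) q k * lowered_coeff a b q (n - k))"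
    (is "?T k * _ = _")
  using \<open>k \<le> n\<close>
proof (induction k)
  case 0
  show ?case by simp
next
  case (Suc k)
  define j z v where "j = n - Suc k" and "z = q ^ k" and "v = q ^ j"
  have n_k: "n - k = Suc j" using Suc.prems by (simp add: j_def)
  have j: "j < n" using Suc.prems by (simp add: j_def)
  have pk: "p ^ k = z ^ 2" and pj: "p ^ j = v ^ 2"
    by (simp_all add: p_def z_def v_def power_mult [symmetric] mult.commute)
  have "n = Suc (k + j)" using Suc.prems by (simp add: j_def)
  then have pn: "p ^ n = q ^ 2 * (z ^ 2 * v ^ 2)"
    by (simp add: power_add pk pj p_def [symmetric])
  have zv: "z \<noteq> 0" "v \<noteq> 0" using q by (simp_all add: z_def v_def)
  have nz: "1 - a * v ^ 2 \<noteq> 0" "1 - b * v ^ 2 \<noteq> 0" "1 - p * v ^ 2 \<noteq> 0"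
    "1 - a * b * q ^ 3 * v ^ 2 \<noteq> 0"
    using qfac_nonzero_factor[OF nz3 j] qfac_nonzero_factor[OF nz4 j]
      qfac_nonzero_factor[OF nz1 j] qfac_nonzero_factor[OF nz2 j] by (simp_all add: pj)
  define M where "M = (1 - a * z ^ 2) * (1 - b * p * z ^ 2) /
      ((1 - p * z ^ 2) * (1 - a * b * q ^ 3 * z ^ 2))"
  define R where "R = (1 - p * v ^ 2) * (1 - a * b * q * v ^ 2) /
      ((1 - a * v ^ 2) * (1 - b * v ^ 2))"
  have "?T (Suc k) = ?T k * ((1 - 1 / p ^ n * z ^ 2) * (1 - a * z ^ 2) * (1 - b * p * z ^ 2) *
      (1 - q / p ^ n / (a * b) * z ^ 2) * q ^ 4 /
      ((1 - p * z ^ 2) * (1 - p / p ^ n / a * z ^ 2) * (1 - p / p ^ n / b * z ^ 2) *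
        (1 - a * b * q ^ 3 * z ^ 2)))"
    by (simp only: qfac_Suc pk power_Suc times_divide_times_eq ac_simps)
  also have "\<dots> = ?T k * (M * ((1 - 1 / p ^ n * z ^ 2) * (1 - q / p ^ n / (a * b) * z ^ 2) * q ^ 4 /
      ((1 - p / p ^ n / a * z ^ 2) * (1 - p / p ^ n / b * z ^ 2))))"
    by (simp only: M_def times_divide_times_eq ac_simps)
  also have "(1 - 1 / p ^ n * z ^ 2) * (1 - q / p ^ n / (a * b) * z ^ 2) * q ^ 4 /
      ((1 - p / p ^ n / a * z ^ 2) * (1 - p / p ^ n / b * z ^ 2)) = q * R"
  proof -
    have e1: "1 - 1 / p ^ n * z ^ 2 = - (1 - p * v ^ 2) / (q ^ 2 * v ^ 2)"
      using zv q unfolding pn by (simp add: p_def field_simps)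
    have e2: "1 - q / p ^ n / (a * b) * z ^ 2 = - (1 - a * b * q * v ^ 2) / (a * b * q * v ^ 2)"
      using zv q a b unfolding pn by (simp add: power2_eq_square divide_simps)
    have e3: "1 - p / p ^ n / a * z ^ 2 = - (1 - a * v ^ 2) / (a * v ^ 2)"
      using zv q a unfolding pn by (simp add: p_def field_simps)
    have e4: "1 - p / p ^ n / b * z ^ 2 = - (1 - b * v ^ 2) / (b * v ^ 2)"
      using zv q b unfolding pn by (simp add: p_def field_simps)
    have "(- A / (q ^ 2 * v ^ 2)) * (- B / (a * b * q * v ^ 2)) * q ^ 4 /
        ((- C / (a * v ^ 2)) * (- E / (b * v ^ 2))) = q * (A * B / (C * E))"
      if "C \<noteq> 0" "E \<noteq> 0" for A B C E
      using that zv q a b by (simp add: power2_eq_square power4_eq_xxxx)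
    then show ?thesis
      unfolding e1 e2 e3 e4 R_def using nz(1,2) .
  qed
  finally have T: "?T (Suc k) = ?T k * (M * (q * R))" .
  have "lowered_coeff a b q (Suc j) * ((1 - p * v ^ 2) * (1 - a * b * q * v ^ 2)) =
      lowered_coeff a b q j * ((1 - a * v ^ 2) * (1 - b * v ^ 2))"
    using lowered_coeff_step[of a b q j] nz by (simp add: p_def v_def)
  then have "lowered_coeff a b q (Suc j) * R = lowered_coeff a b q j"
    using nz(1,2) by (simp add: R_def divide_eq_eq)
  moreover have "clausen_coeff a (b * p) q (Suc k) = clausen_coeff a (b * p) q k * M"
    using clausen_coeff_Suc[of a "b * p" q k]
    by (simp add: M_def p_def z_def [symmetric] power2_eq_square power3_eq_cube mult.assoc)
  moreover have "?T k * lowered_coeff a b q n =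
      q ^ k * (clausen_coeff a (b * p) q k * lowered_coeff a b q (Suc j))"
    using Suc by (simp only: n_k Suc_leD)
  then have "?T (Suc k) * lowered_coeff a b q n =
      q ^ k * (clausen_coeff a (b * p) q k * lowered_coeff a b q (Suc j)) * (M * (q * R))"
    unfolding T by (simp only: ac_simps)
  ultimately show ?case
    unfolding j_def [symmetric] by (simp add: ac_simps)
qed

section \<open>The summation formula\<close>

theorem mainTheorem5:
  fixes n :: nat and q a b :: complex
  assumes "q \<noteq> 0" and "a \<noteq> 0" and "b \<noteq> 0"
    and "\<And>k. k \<le> n \<Longrightarrow>
      qpochs [q ^ 2, q powi (2 - 2 * int n) / a, q powi (2 - 2 * int n) / b, a * b * q ^ 3]
        (q ^ 2) (int k) \<noteq> 0"
    and "1 - a * b * q ^ (2 * n + 1) \<noteq> 0"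
    and "qpoch (a * b * q ^ 2) q (int n - 1) \<noteq> 0"
    and "qpochs [a, b] (q ^ 2) (int n) \<noteq> 0"
    \<comment> \<open>for \<open>n = 0\<close> the factors of index \<open>-1\<close> are themselves fractions\<close>
    and "n = 0 \<Longrightarrow> 1 - b * q ^ 2 / q \<noteq> 0"
    and "n = 0 \<Longrightarrow> 1 - a * b * q ^ 2 / q ^ 2 \<noteq> 0"
    and "n = 0 \<Longrightarrow> 1 - a * b * q ^ 2 / q \<noteq> 0"
  shows "phi43 (q powi (- 2 * int n)) a (b * q ^ 2) (q powi (1 - 2 * int n) / (a * b))
           (q powi (2 - 2 * int n) / a) (q powi (2 - 2 * int n) / b) (a * b * q ^ 3)
           (q ^ 2) (q ^ 4) =
         (qpochs [a, - q] q (int n) * qpoch (b * q ^ 2) q (int n - 1)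
           * qpoch (a * b * q ^ 2) (q ^ 2) (int n - 1)
           * (a * b * q ^ (2 * n) * (b * q - 1) + b * q ^ n * (1 - q) + 1 - b))
         / ((1 - a * b * q ^ (2 * n + 1)) * qpoch (a * b * q ^ 2) q (int n - 1)
           * qpochs [a, b] (q ^ 2) (int n))"
proof -
  note q = assms(1)
  define p where "p = q ^ 2"
  have pn: "q ^ (2 * n) = p ^ n" by (simp add: p_def power_mult)
  have neg: "q powi (- 2 * int n) = 1 / p ^ n"
    using q by (simp add: power_int_minus pn [symmetric] power_int_def nat_mult_distrib field_simps)
  have powi: "q powi (1 - 2 * int n) = q / p ^ n" "q powi (2 - 2 * int n) = p / p ^ n"
    "q powi (- 2 * int n) = p powi (- int n)"
    using q neg power_int_add[of q 1 "- 2 * int n"] power_int_add[of q 2 "- 2 * int n"]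
    by (simp_all add: p_def power_int_minus divide_inverse)
  have phi: "phi43 (q powi (- 2 * int n)) a (b * q ^ 2) (q powi (1 - 2 * int n) / (a * b))
           (q powi (2 - 2 * int n) / a) (q powi (2 - 2 * int n) / b) (a * b * q ^ 3)
           (q ^ 2) (q ^ 4) =
    (\<Sum>k\<le>n. qfac (1 / p ^ n) p k * qfac a p k * qfac (b * p) p k *
        qfac (q / p ^ n / (a * b)) p k * (q ^ 4) ^ k /
      (qfac p p k * qfac (p / p ^ n / a) p k * qfac (p / p ^ n / b) p k *
        qfac (a * b * q ^ 3) p k))" (is "?phi = (\<Sum>k\<le>n. ?T k)")
    using phi43_terminating[of p n] q
    unfolding powi p_def [symmetric]
    by (simp add: p_def [symmetric] qpochs_def qpoch_of_nat power_int_minus divide_inverse mult.assoc)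
       (simp add: p_def)
  show ?thesis
  proof (cases n)
    case 0
    \<comment> \<open>the quadratic polynomial cancels the factors of index \<open>-1\<close>\<close>
    have "(a * b * (b * q - 1) + b * (1 - q) + 1 - b) = (1 - b * q) * (1 - a * b)"
      by (simp add: algebra_simps)
    then show ?thesis
      using assms(8-10) q unfolding phi
      by (simp add: 0 qpochs_def qpoch_minus_one) (simp add: qpoch_def power2_eq_square mult.assoc)
  next
    case (Suc m)
    have qm: "int n - 1 = int m" by (simp add: Suc)
    have nz: "qfac p p n \<noteq> 0" "qfac (a * b * q ^ 3) p n \<noteq> 0" "qfac a p n \<noteq> 0" "qfac b p n \<noteq> 0"
      "qfac (a * b * p) q m \<noteq> 0" "1 - a * b * q * (q ^ n) ^ 2 \<noteq> 0"
      using assms(4)[of n] assms(6,7) assms(5)[unfolded power_add power_mult]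
      by (auto simp add: qpochs_def qpoch_of_nat p_def [symmetric] qm)
         (simp add: p_def power_mult [symmetric] ac_simps)
    define u L D where "u = lowered_coeff a b q n"
      and "L = a * b * (q ^ n) ^ 2 * (b * q - 1) + b * q ^ n * (1 - q) + 1 - b"
      and "D = clausen_sum a (b * q ^ 2) q m"
    have pq: "a * b * p * q = a * b * q ^ 3"
      by (simp add: p_def power2_eq_square power3_eq_cube)
    have cn: "a * b * q ^ 3 * p ^ m = a * b * q * (q ^ n) ^ 2"
      by (simp add: Suc p_def power_mult_distrib power3_eq_cube power2_eq_square ac_simps)
    have nz': "qfac q q n \<noteq> 0" "qfac (- q) q n \<noteq> 0"
      using nz(1) by (simp_all add: p_def qfac_square)
    have "qfac q q m \<noteq> 0" and q_n: "1 - q ^ n \<noteq> 0"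
      using nz'(1) by (simp_all add: Suc qfac_Suc)
    have nzm: "qfac p p m \<noteq> 0" "qfac (a * b * q ^ 3) p m \<noteq> 0"
      using nz(1,2) by (simp_all add: Suc qfac_Suc)
    have den: "qfac (a * b * q ^ 3) p n = qfac (a * b * q ^ 3) p m * (1 - a * b * q * (q ^ n) ^ 2)"
      by (simp only: Suc qfac_Suc cn [unfolded Suc])
    have u: "u = qfac a p n * qfac b p n / (qfac p p n * qfac (a * b * q ^ 3) p m)"
      using nz(6) unfolding u_def lowered_coeff_def p_def [symmetric] den
      by simp
    then have u_nz: "u \<noteq> 0"
      using nz nzm by simp
    have "?phi * u = (\<Sum>k\<le>n. q ^ k * (clausen_coeff a (b * p) q k * lowered_coeff a b q (n - k)))"
      unfolding phi sum_distrib_right u_def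
      using reversed_term[of q a b n, folded p_def, OF assms(1-3) nz(1-4)]
      by (intro sum.cong refl) (simp only: atMost_iff)
    then have "(1 - q ^ n) * (1 - a * b * q * (q ^ n) ^ 2) * (?phi * u) = (1 - a * q ^ m) * L * D"
      using lowered_sum[of q m a b] q nz(1,2)
      by (simp only: L_def D_def p_def Suc simp_thms not_False_eq_True)
    then have phi_D: "?phi = (1 - a * q ^ m) * L * D / ((1 - q ^ n) * (1 - a * b * q * (q ^ n) ^ 2) * u)"
      using q_n nz(6) u_nz by (simp only: nonzero_eq_divide_eq mult_eq_0_iff simp_thms ac_simps)
    have D: "D = qfac a q m * qfac (b * p) q m * qfac (a * b * p) p m /
           (qfac q q m * qfac (a * b * p) q m * qfac (a * b * q ^ 3) p m)"
      using clausen_sum_closed_form[of q m a "b * p"] q nzm nz(5)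
      by (simp add: D_def p_def [symmetric] mult.assoc [symmetric] pq)
    have pp: "qfac p p n = qfac q q m * (1 - q ^ n) * qfac (- q) q n"
      by (simp add: p_def qfac_square) (simp add: Suc qfac_Suc)
    have pw: "q ^ (2 * n) = (q ^ n) ^ 2" "a * b * q ^ (2 * n + 1) = a * b * q * (q ^ n) ^ 2"
      by (simp_all add: power_mult [symmetric] mult.commute)
    have an: "qfac a q n = qfac a q m * (1 - a * q ^ m)"
      by (simp add: Suc qfac_Suc)
    show ?thesis
      unfolding phi_D D u pp qm qpochs_def qpoch_of_nat pw L_def [symmetric]
      using nz nzm nz' q_n \<open>qfac q q m \<noteq> 0\<close> by (simp add: an p_def [symmetric] ac_simps)
  qed
qed

end
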